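(* Let $I$ be either a closed interval contained in $S^1$ or $S^1$ itself, let $f_1,\dots,f_n: I\to I$ be continuous open functions, and let $M\subset I$ be a minimal set for $IFS(f_1,\dots,f_n)$. Write $M=\mathcal{I}\cup K\cup N$ for the canonical decomposition of the closed set $M$ (see context). Then: (1) If $\mathrm{int}(M)=\emptyset$, then $M$ is finite or $M$ is a Cantor set. (2) If $\mathrm{int}(M)\neq\emptyset$, then one of the following holds: - $M=S^1$; - $M=\mathcal{I}\cup K\cup N$ with $\partial\mathcal{I}\cap N\neq\emptyset$; - $M=\mathcal{I}\cup N$ (that is, $K=\emptyset$); - $M=\mathcal{I}\cup K$ (that is, $N=\emptyset$).
   Context: $IFS(f_1,\dots,f_n)$ is the set of all finite compositions (finite words) of the maps $f_1,\dots,f_n$. The orbit of $x$ is $O(x)=\{\phi(x):\phi\in IFS(f_1,\dots,f_n)\}$. A set $M$ is invariant if $f_i(M)\subset M$ for every $i$. A nonempty set $M$ is minimal for the IFS if it is closed in $S^1$, invariant, and $\overline{O(x)}=M$ for every $x\in M$. A function $f:I\to I$ is open if it maps open subsets of $I$ to open subsets of $I$. A Cantor set is a nonempty compact, perfect, totally disconnected set. Canonical decomposition: every closed set $M\subset S^1$ is written uniquely as a disjoint union $M=\mathcal{I}\cup K\cup N$, where $\mathcal{I}$ is the union of the connected components of $\mathrm{int}(M)$ (so $\mathcal I=\mathrm{int}(M)$), $K$ is the maximal (with respect to inclusion) Cantor set contained in $M\setminus\mathcal{I}$, with $K=\emptyset$ if there is none, and $N=M\setminus(\mathcal I\cup K)$,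 which is a countable (possibly finite or empty) set. $\partial\mathcal{I}$ is the topological boundary of $\mathcal{I}$ in $S^1$. *)

theory Defs
  imports "HOL-Analysis.Analysis"
begin

abbreviation circle :: "complex set"
  where "circle \<equiv> sphere 0 1"

text \<open>Closed subintervals of the circle are the proper closed arcs; one-point arcs are allowed.\<close>

definition circle_closed_interval :: "complex set \<Rightarrow> bool"
  where "circle_closed_interval I \<longleftrightarrow>
    (\<exists>a b. a \<le> b \<and> b < a + 2 * pi \<and> I = cis ` {a..b})"

text \<open>Words range over the index set \<open>{1..n}\<close>; the empty word contributes the identity.\<close>

definition IFS :: "nat \<Rightarrow> (nat \<Rightarrow> 'a \<Rightarrow> 'a) \<Rightarrow> ('a \<Rightarrow> 'a) set"
  where "IFS n f = {foldr (\<circ>) (map f w) id | w. w \<in> lists {1..n}}"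

definition orbit_IFS :: "nat \<Rightarrow> (nat \<Rightarrow> 'a \<Rightarrow> 'a) \<Rightarrow> 'a \<Rightarrow> 'a set"
  where "orbit_IFS n f x = {\<phi> x | \<phi>. \<phi> \<in> IFS n f}"

definition invariant_IFS :: "nat \<Rightarrow> (nat \<Rightarrow> 'a \<Rightarrow> 'a) \<Rightarrow> 'a set \<Rightarrow> bool"
  where "invariant_IFS n f M \<longleftrightarrow> (\<forall>i\<in>{1..n}. f i ` M \<subseteq> M)"

definition minimal_IFS :: "nat \<Rightarrow> (nat \<Rightarrow> complex \<Rightarrow> complex) \<Rightarrow> complex set \<Rightarrow> bool"
  where "minimal_IFS n f M \<longleftrightarrow>
    M \<noteq> {} \<and> closedin (top_of_set circle) M \<and> invariant_IFS n f M \<and>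
    (\<forall>x\<in>M. top_of_set circle closure_of orbit_IFS n f x = M)"

definition cantor_set :: "'a::topological_space set \<Rightarrow> bool"
  where "cantor_set C \<longleftrightarrow>
    C \<noteq> {} \<and> compact C \<and> (\<forall>x\<in>C. x islimpt C) \<and>
    (\<forall>T. T \<subseteq> C \<and> connected T \<longrightarrow> (\<exists>x. T \<subseteq> {x}))"

definition maximal_cantor_subset :: "'a::topological_space set \<Rightarrow> 'a set \<Rightarrow> bool"
  where "maximal_cantor_subset A K \<longleftrightarrow>
    cantor_set K \<and> K \<subseteq> A \<and> (\<forall>C. cantor_set C \<and> C \<subseteq> A \<and> K \<subseteq> C \<longrightarrow> C = K)"

definition interior_part :: "complex set \<Rightarrow> complex set"
  where "interior_part M = top_of_set circle interior_of M"

text \<open>The \<open>THE\<close> is well defined for closed \<open>M\<close>: see \<open>canonical_decomposition\<close> below.\<close>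

definition cantor_part :: "complex set \<Rightarrow> complex set"
  where "cantor_part M =
    (if \<exists>C. cantor_set C \<and> C \<subseteq> M - interior_part M
     then (THE K. maximal_cantor_subset (M - interior_part M) K) else {})"

definition countable_part :: "complex set \<Rightarrow> complex set"
  where "countable_part M = M - (interior_part M \<union> cantor_part M)"


subsection \<open>Existence and uniqueness of the canonical decomposition\<close>

lemma cis_inj_short:
  assumes "cis s = cis t" "\<bar>s - t\<bar> < 2 * pi"
  shows "s = t"
proof -
  have "cis (s - t) = 1"
    using assms(1) by (simp flip: cis_divide)
  then have "cos (s - t) = 1"
    by (metis cis.simps(1) one_complex.simps(1))
  then obtain k :: int where k: "s - t = of_int k * 2 * pi"
    using cos_one_2pi_int by blast
  have "\<bar>of_int k\<bar> * (2 * pi) < 1 * (2 * pi)"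
    using assms(2) k by (simp add: abs_mult)
  then have "\<bar>real_of_int k\<bar> < 1"
    by (metis mult_less_cancel_right_pos pi_gt_zero zero_less_mult_iff zero_less_numeral)
  then have "k = 0" by linarith
  then show ?thesis using k by simp
qed

lemma circle_eq_cis:
  assumes "z \<in> circle"
  obtains t where "a \<le> t" "t < a + 2 * pi" "z = cis t"
proof -
  have z: "z = cis (Arg z)"
  proof -
    have "norm z = 1" using assms by simp
    then have "z \<noteq> 0" "sgn z = z" by (auto simp: sgn_eq)
    then show ?thesis using cis_Arg[of z] by simp
  qed
  define k where "k = \<lfloor>(Arg z - a) / (2 * pi)\<rfloor>"
  define t where "t = Arg z - of_int k * (2 * pi)"
  have "of_int k \<le> (Arg z - a) / (2 * pi)" "(Arg z - a) / (2 * pi) < of_int k + 1"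
    unfolding k_def by linarith+
  then have "a \<le> t" "t < a + 2 * pi"
    unfolding t_def by (simp_all add: field_simps)
  moreover have "cis t = cis (Arg z)"
    using cis_multiple_2pi[of "of_int k"] unfolding t_def
    by (simp add: mult.commute mult.left_commute flip: cis_divide)
  ultimately show ?thesis using that z by metis
qed

lemma openin_arc:
  assumes "a < b" "b \<le> a + 2 * pi"
  shows "openin (top_of_set circle) (cis ` {a<..<b})"
proof -
  have eq: "circle - cis ` {b..a + 2 * pi} = cis ` {a<..<b}" (is "?L = ?R")
  proof
    show "?L \<subseteq> ?R"
    proof
      fix z assume z: "z \<in> ?L"
      then obtain t where t: "a \<le> t" "t < a + 2 * pi" "z = cis t"
        using circle_eq_cis by blast
      have "z \<noteq> cis (a + 2 * pi)" using z assms by auto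
      then have "t \<noteq> a" using t by (auto simp flip: cis_mult)
      then show "z \<in> ?R" using z t by force
    qed
    show "?R \<subseteq> ?L"
    proof
      fix z assume "z \<in> ?R"
      then obtain t where t: "a < t" "t < b" "z = cis t" by auto
      have "z \<noteq> cis s" if "s \<in> {b..a + 2 * pi}" for s
        using cis_inj_short[of t s] t that assms by auto
      moreover have "z \<in> circle" using t by simp
      ultimately show "z \<in> ?L" by blast
    qed
  qed
  have "closed (cis ` {b..a + 2 * pi})"
    by (intro compact_imp_closed compact_continuous_image continuous_intros) auto
  then have "closedin (top_of_set circle) (cis ` {b..a + 2 * pi})"
    by (intro closed_subset) auto
  then have "openin (top_of_set circle) (topspace (top_of_set circle) - cis ` {b..a + 2 * pi})"
    unfolding closedin_def by (rule conjunct2)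
  then show ?thesis
    using eq by simp
qed

lemma connected_subset_residual:
  assumes "closedin (top_of_set circle) M" "connected T" "T \<subseteq> M - interior_part M"
  shows "\<exists>x. T \<subseteq> {x}"
proof (rule ccontr)
  assume "\<not> ?thesis"
  then obtain x y where xy: "x \<in> T" "y \<in> T" "x \<noteq> y" by blast
  have sub: "M \<subseteq> circle" using assms(1) closedin_subset by fastforce
  obtain \<alpha> where \<alpha>: "x = cis \<alpha>" using xy assms sub circle_eq_cis by (metis DiffD1 subset_eq)
  obtain \<beta> where \<beta>: "\<alpha> \<le> \<beta>" "\<beta> < \<alpha> + 2 * pi" "y = cis \<beta>"
    using xy assms sub circle_eq_cis by (metis DiffD1 subset_eq)
  have "\<alpha> < \<beta>" using \<alpha> \<beta> xy by (cases "\<alpha> = \<beta>") auto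
  have outside: "\<exists>t\<in>{a<..<b}. cis t \<notin> T" if "a < b" "b \<le> a + 2 * pi" for a b
  proof (rule ccontr)
    assume "\<not> ?thesis"
    then have "cis ` {a<..<b} \<subseteq> M - interior_part M" using assms(3) by auto
    moreover from this have "cis ` {a<..<b} \<subseteq> interior_part M"
      unfolding interior_part_def
      by (intro interior_of_maximal openin_arc that) auto
    moreover obtain c where "c \<in> {a<..<b}" using dense[OF \<open>a < b\<close>] by auto
    ultimately show False by blast
  qed
  obtain \<rho> where \<rho>: "\<alpha> < \<rho>" "\<rho> < \<beta>" "cis \<rho> \<notin> T"
    using outside[of \<alpha> \<beta>] \<open>\<alpha> < \<beta>\<close> \<beta> by auto
  obtain \<sigma> where \<sigma>: "\<beta> < \<sigma>" "\<sigma> < \<alpha> + 2 * pi" "cis \<sigma> \<notin> T"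
    using outside[of \<beta> "\<alpha> + 2 * pi"] \<open>\<alpha> < \<beta>\<close> \<beta> by auto
  define U where "U = cis ` {\<rho><..<\<sigma>}"
  define V where "V = cis ` {\<sigma><..<\<rho> + 2 * pi}"
  have oT: "openin (top_of_set T) (T \<inter> W)" if W: "openin (top_of_set circle) W" for W
  proof -
    obtain S where "open S" "W = circle \<inter> S" using W unfolding openin_open by metis
    moreover have "T \<subseteq> circle" using assms(3) sub by blast
    ultimately have "T \<inter> W = T \<inter> S" by blast
    then show ?thesis using \<open>open S\<close> by (metis openin_open_Int)
  qed
  have oU: "openin (top_of_set T) (T \<inter> U)"
    unfolding U_def using \<rho> \<sigma> by (intro oT openin_arc) linarith+
  have oV: "openin (top_of_set T) (T \<inter> V)"
    unfolding V_def using \<rho> \<sigma> by (intro oT openin_arc) linarith+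
  have cov: "T \<subseteq> (T \<inter> U) \<union> (T \<inter> V)"
  proof
    fix z assume z: "z \<in> T"
    then obtain t where t: "\<rho> \<le> t" "t < \<rho> + 2 * pi" "z = cis t"
      using circle_eq_cis assms(3) sub by (metis DiffD1 subset_eq)
    then have "t \<noteq> \<rho>" "t \<noteq> \<sigma>" using \<rho> \<sigma> z by auto
    then show "z \<in> (T \<inter> U) \<union> (T \<inter> V)" using t z unfolding U_def V_def by force
  qed
  have "U \<inter> V = {}"
  proof -
    have False if "\<rho> < s" "s < \<sigma>" "\<sigma> < t" "t < \<rho> + 2 * pi" "cis s = cis t" for s t
      using cis_inj_short[of s t] that by auto
    then show ?thesis unfolding U_def V_def by auto
  qed
  moreover have "y \<in> U" unfolding U_def using \<beta> \<rho> \<sigma> by auto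
  moreover have "x \<in> V"
  proof -
    have "x = cis (\<alpha> + 2 * pi)" using \<alpha> by (simp flip: cis_mult)
    then show ?thesis unfolding V_def using \<beta> \<rho> \<sigma> by auto
  qed
  ultimately have "(T \<inter> U) \<inter> (T \<inter> V) = {}" "T \<inter> U \<noteq> {}" "T \<inter> V \<noteq> {}"
    using xy by auto
  then show False
    using assms(2) oU oV cov unfolding connected_openin by metis
qed

lemma countable_minus_perfect:
  fixes A :: "'a::{second_countable_topology, t1_space} set"
  assumes "closed A"
  obtains Q where "closed Q" "Q \<subseteq> A" "\<forall>x\<in>Q. x islimpt Q" "countable (A - Q)"
proof -
  obtain B :: "'a set set" where B: "countable B" "topological_basis B"
    using ex_countable_basis by blast
  define W where "W = \<Union>{b \<in> B. countable (b \<inter> A)}"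
  have "open W"
    unfolding W_def using B topological_basis_open by (intro open_Union) blast
  have "countable (W \<inter> A)"
  proof -
    have "W \<inter> A = (\<Union>b\<in>{b \<in> B. countable (b \<inter> A)}. b \<inter> A)" unfolding W_def by auto
    moreover have "countable (\<Union>b\<in>{b \<in> B. countable (b \<inter> A)}. b \<inter> A)"
      using B(1) by (intro countable_UN) auto
    ultimately show ?thesis by simp
  qed
  moreover have "A - (A - W) = W \<inter> A" by auto
  ultimately have cnt: "countable (A - (A - W))" by simp
  have "x islimpt (A - W)" if x: "x \<in> A - W" for x
  proof (rule islimptI)
    fix T assume T: "x \<in> T" "open T"
    then obtain b where b: "b \<in> B" "x \<in> b" "b \<subseteq> T"
      using B(2) topological_basisE by metis
    then have "uncountable (b \<inter> A)" using x unfolding W_def by auto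
    then have "uncountable (b \<inter> A - ((A - (A - W)) \<union> {x}))"
      using cnt by (intro uncountable_minus_countable) auto
    then have "b \<inter> A - ((A - (A - W)) \<union> {x}) \<noteq> {}" by (metis countable_empty)
    then show "\<exists>y\<in>A - W. y \<in> T \<and> y \<noteq> x" using b by auto
  qed
  then show ?thesis
    using that[of "A - W"] cnt assms \<open>open W\<close> by (simp add: closed_Diff)
qed

theorem canonical_decomposition:
  assumes M: "closedin (top_of_set circle) M"
  shows "M = interior_part M \<union> cantor_part M \<union> countable_part M"
    and "interior_part M \<inter> cantor_part M = {}"
    and "(interior_part M \<union> cantor_part M) \<inter> countable_part M = {}"
    and "countable (countable_part M)"
    and "if \<exists>C. cantor_set C \<and> C \<subseteq> M - interior_part M
         then maximal_cantor_subset (M - interior_part M) (cantor_part M) \<and>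
              (\<forall>C. cantor_set C \<and> C \<subseteq> M - interior_part M \<longrightarrow> C \<subseteq> cantor_part M)
         else cantor_part M = {}"
proof -
  define A where "A = M - interior_part M"
  have "closedin (top_of_set circle) A"
    unfolding A_def interior_part_def using M by (intro closedin_diff openin_interior_of)
  then have "closed A" using closedin_closed_trans[OF _ closed_sphere] by blast
  moreover have "A \<subseteq> circle" using \<open>closedin (top_of_set circle) A\<close> closedin_subset by fastforce
  ultimately have "compact A"
    by (metis bounded_sphere bounded_subset compact_eq_bounded_closed)
  have cantorI: "cantor_set C" if "C \<noteq> {}" "closed C" "C \<subseteq> A" "\<forall>x\<in>C. x islimpt C" for C
  proof -
    have "compact C" using that \<open>compact A\<close> by (metis compact_Int_closed inf.absorb2)
    then show ?thesis
      unfolding cantor_set_def using that connected_subset_residual[OF M]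
      by (metis A_def order_trans)
  qed
  define P where "P = closure (\<Union>{C. cantor_set C \<and> C \<subseteq> A})"
  have "P \<subseteq> A"
    unfolding P_def using \<open>closed A\<close> by (intro closure_minimal) auto
  have up: "C \<subseteq> P" if "cantor_set C" "C \<subseteq> A" for C
    unfolding P_def using that by (intro order_trans[OF Union_upper closure_subset]) simp
  have perf: "\<forall>x\<in>P. x islimpt P"
  proof
    fix x assume "x \<in> P"
    then consider C where "cantor_set C" "C \<subseteq> A" "x \<in> C"
      | "x islimpt \<Union>{C. cantor_set C \<and> C \<subseteq> A}"
      unfolding P_def closure_def by auto
    then show "x islimpt P"
    proof cases
      case 1
      then have "x islimpt C" unfolding cantor_set_def by simp
      then show ?thesis using up 1 by (rule_tac islimpt_subset)
    next
      case 2
      then show ?thesis unfolding P_def by (rule islimpt_subset) (rule closure_subset)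
    qed
  qed
  have PK: "cantor_part M = P" and spec: "if \<exists>C. cantor_set C \<and> C \<subseteq> A
         then maximal_cantor_subset A P \<and> (\<forall>C. cantor_set C \<and> C \<subseteq> A \<longrightarrow> C \<subseteq> P) else P = {}"
  proof -
    have "cantor_part M = P \<and> maximal_cantor_subset A P"
      if ex: "\<exists>C. cantor_set C \<and> C \<subseteq> A"
    proof -
      obtain C where "cantor_set C" "C \<subseteq> A" using ex by blast
      then have "P \<noteq> {}" using up[of C] unfolding cantor_set_def by auto
      then have P: "cantor_set P" using cantorI perf \<open>P \<subseteq> A\<close> P_def by auto
      then have m: "maximal_cantor_subset A P"
        unfolding maximal_cantor_subset_def using up \<open>P \<subseteq> A\<close> by blast
      moreover have "K = P" if "maximal_cantor_subset A K" for K
        using that up P \<open>P \<subseteq> A\<close> unfolding maximal_cantor_subset_def by metis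
      ultimately have "(THE K. maximal_cantor_subset A K) = P" by (rule the_equality)
      then show ?thesis using ex m unfolding cantor_part_def A_def by simp
    qed
    moreover have "cantor_part M = {} \<and> P = {}" if "\<nexists>C. cantor_set C \<and> C \<subseteq> A"
    proof -
      have "{C. cantor_set C \<and> C \<subseteq> A} = {}" using that by blast
      then have "P = {}" unfolding P_def by (simp only: Union_empty closure_empty)
      then show ?thesis using that unfolding cantor_part_def A_def by (simp only: if_False)
    qed
    ultimately show "cantor_part M = P" "if \<exists>C. cantor_set C \<and> C \<subseteq> A
         then maximal_cantor_subset A P \<and> (\<forall>C. cantor_set C \<and> C \<subseteq> A \<longrightarrow> C \<subseteq> P) else P = {}"
      using up by (metis, simp)
  qed
  have "interior_part M \<subseteq> M" unfolding interior_part_def by (rule interior_of_subset)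
  then show "M = interior_part M \<union> cantor_part M \<union> countable_part M"
    using \<open>P \<subseteq> A\<close> PK unfolding A_def countable_part_def by blast
  show "interior_part M \<inter> cantor_part M = {}"
    using \<open>P \<subseteq> A\<close> PK unfolding A_def by blast
  show "(interior_part M \<union> cantor_part M) \<inter> countable_part M = {}"
    unfolding countable_part_def by blast
  obtain Q where Q: "closed Q" "Q \<subseteq> A" "\<forall>x\<in>Q. x islimpt Q" "countable (A - Q)"
    using countable_minus_perfect[OF \<open>closed A\<close>] by blast
  have "Q \<subseteq> P" using cantorI[of Q] up[of Q] Q by blast
  then have "countable_part M \<subseteq> A - Q"
    unfolding countable_part_def PK A_def by blast
  then show "countable (countable_part M)" using Q countable_subset by blast
  show "if \<exists>C. cantor_set C \<and> C \<subseteq> M - interior_part M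
         then maximal_cantor_subset (M - interior_part M) (cantor_part M) \<and>
              (\<forall>C. cantor_set C \<and> C \<subseteq> M - interior_part M \<longrightarrow> C \<subseteq> cantor_part M)
         else cantor_part M = {}"
    using spec unfolding PK A_def .
qed

end

theory Submission
  imports Defs
begin

text \<open>The dynamics enters only through one dichotomy: a minimal set \<open>M\<close> is finite or has no isolated
  points.

  The reason is that continuous open maps of an arc or of the circle have finite fibres
  (\<open>finite_fibre_open_map\<close>), a property that passes to compositions. Such maps need not be locally
  injective, since they may fold where the value is an end point of the arc, but infinitely many points
  over the same value \<open>x\<close> would force infinitely many excursions away from \<open>x\<close>, each of fixed minimal size. Now
  let \<open>x\<close> be an isolated point of \<open>M\<close>. Every point of \<open>M\<close> is sent to \<open>x\<close> by some word, because its
  orbit is dense in \<open>M\<close>. If \<open>M\<close> were infinite, then some word would send an accumulation point of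
  \<open>M\<close>, and with it infinitely many points of \<open>M\<close>, to \<open>x\<close>
  (\<open>minimal_IFS_finite_or_perfect\<close>).

  The rest is topology of the circle. A closed set with empty interior is totally disconnected, so
  a perfect minimal set with empty interior is a Cantor set. A minimal set with nonempty interior
  is infinite, hence perfect. If its countable part avoided the boundary of its interior part, it
  would be relatively open in \<open>M\<close>, so it would contain a Cantor set as soon as it is nonempty, against
  the maximality of the Cantor part (\<open>frontier_meets_countable_part\<close>). Hence either the countable
  part is empty or it meets that boundary.\<close>

section \<open>Arcs of the circle\<close>

lemma circle_eq_cis_image: "circle = cis ` {a..a + 2 * pi}"
proof
  show "circle \<subseteq> cis ` {a..a + 2 * pi}"
  proof
    fix z assume "z \<in> circle"
    then obtain t where "a \<le> t" "t < a + 2 * pi" "z = cis t" by (rule circle_eq_cis)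
    then show "z \<in> cis ` {a..a + 2 * pi}" by simp
  qed
qed auto

lemma arc_or_circle_parametrization:
  assumes "I = circle \<or> circle_closed_interval I" "infinite I"
  obtains a b where "a < b" "b \<le> a + 2 * pi" "I = cis ` {a..b}"
  using assms(1)
proof
  assume "I = circle"
  then show ?thesis using that[of 0 "2 * pi"] circle_eq_cis_image[of 0] by simp
next
  assume "circle_closed_interval I"
  then obtain a b where ab: "a \<le> b" "b < a + 2 * pi" "I = cis ` {a..b}"
    unfolding circle_closed_interval_def by blast
  then have "a \<noteq> b" using assms(2) by auto
  then show ?thesis using that[of a b] ab by simp
qed

lemma connected_arc:
  fixes T :: "real set"
  assumes "connected T"
  shows "connected (cis ` T)"
  using assms by (intro connected_continuous_image continuous_intros)

text \<open>On a full circle the cut is made at the deleted point, so that what remains is a single open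
  arc; in a proper arc \<open>cis\<close> is injective and deleting a point leaves the two sides.\<close>

lemma arc_or_circle_minus_point:
  assumes "I = circle \<or> circle_closed_interval I" "x \<in> I"
  obtains C D where "connected C" "connected D" "I - {x} = C \<union> D"
  using assms(1)
proof
  assume I: "I = circle"
  then obtain a where x: "x = cis a" using assms(2) circle_eq_cis[of x 0] by blast
  have "I - {x} = cis ` {a<..<a + 2 * pi} \<union> {}"
  proof (intro equalityI subsetI)
    fix z assume z: "z \<in> I - {x}"
    then obtain t where t: "a \<le> t" "t < a + 2 * pi" "z = cis t"
      using I circle_eq_cis by blast
    then have "t \<noteq> a" using z x by auto
    then show "z \<in> cis ` {a<..<a + 2 * pi} \<union> {}" using t by auto
  next
    fix z assume "z \<in> cis ` {a<..<a + 2 * pi} \<union> {}"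
    then obtain t where t: "a < t" "t < a + 2 * pi" "z = cis t" by auto
    then have "z \<noteq> x" using cis_inj_short[of t a] x by auto
    then show "z \<in> I - {x}" using I t by simp
  qed
  then show ?thesis by (intro that[of "cis ` {a<..<a + 2 * pi}" "{}"] connected_arc) auto
next
  assume "circle_closed_interval I"
  then obtain a b where ab: "a \<le> b" "b < a + 2 * pi" "I = cis ` {a..b}"
    unfolding circle_closed_interval_def by blast
  then obtain c where c: "a \<le> c" "c \<le> b" "x = cis c" using assms(2) by auto
  have "cis t \<noteq> x" if "t \<in> {a..<c} \<union> {c<..b}" for t
    using cis_inj_short[of t c] that c ab(2) by (auto simp: abs_less_iff)
  then have "x \<notin> cis ` {a..<c} \<union> cis ` {c<..b}" by blast
  moreover have "{a..b} = {a..<c} \<union> {c} \<union> {c<..b}" using c by auto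
  then have "I = cis ` {a..<c} \<union> {x} \<union> cis ` {c<..b}" using c(3) ab(3) by (simp add: image_Un)
  ultimately have "I - {x} = cis ` {a..<c} \<union> cis ` {c<..b}" by blast
  then show ?thesis by (intro that[of "cis ` {a..<c}" "cis ` {c<..b}"] connected_arc) auto
qed

lemma islimpt_arc_or_circle:
  assumes "I = circle \<or> circle_closed_interval I" "infinite I" "x \<in> I"
  shows "x islimpt I"
proof -
  obtain a b where "I = cis ` {a..b}" using arc_or_circle_parametrization[OF assms(1,2)] .
  then have "connected I" by (auto intro: connected_arc)
  then show ?thesis using assms(2,3) by (intro connected_imp_perfect) auto
qed

lemma infinite_circle: "infinite circle"
proof -
  have "inj_on cis {0..1}"
  proof (rule inj_onI)
    fix s t :: real assume "s \<in> {0..1}" "t \<in> {0..1}" and eq: "cis s = cis t"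
    then have "\<bar>s - t\<bar> < 2 * pi" using pi_gt3 by (simp add: abs_less_iff)
    then show "s = t" by (rule cis_inj_short[OF eq])
  qed
  then have "infinite (cis ` {0..1})" by (simp add: finite_image_iff)
  then show ?thesis by (rule infinite_super[rotated]) auto
qed

section \<open>Fibres of continuous open maps\<close>

lemma nonempty_clopen_contains_connected_piece:
  assumes "connected C" "connected D" "S = C \<union> D" "T \<noteq> {}"
    and "openin (top_of_set S) T" "closedin (top_of_set S) T"
  shows "C \<noteq> {} \<and> C \<subseteq> T \<or> D \<noteq> {} \<and> D \<subseteq> T"
proof -
  have piece: "B \<inter> T = {} \<or> B \<subseteq> T" if "connected B" "B \<subseteq> S" for B
  proof -
    have "openin (top_of_set B) (B \<inter> T)" "closedin (top_of_set B) (B \<inter> T)"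
      using assms(5,6) that(2)
      by (auto simp: openin_open closedin_closed Int_absorb1 inf_assoc[symmetric])
    then show ?thesis using that(1) unfolding connected_clopen by blast
  qed
  have "T \<subseteq> C \<union> D" using assms(3,5) openin_imp_subset by blast
  then show ?thesis using piece[of C] piece[of D] assms(1-4) by blast
qed

text \<open>Between two parameters with the same image \<open>x\<close>, the path \<open>f \<circ> cis\<close> must sweep out a
  nonempty subset of \<open>I - {x}\<close> that is open, because \<open>f\<close> is open, and closed, because the image of
  the closed parameter interval adds nothing but \<open>x\<close>. As \<open>I - {x}\<close> has at most two components, at
  least one of two fixed test points is attained on the way. By continuity such returns to \<open>x\<close>
  cannot accumulate.\<close>

lemma finite_fibre_open_map:
  assumes I: "I = circle \<or> circle_closed_interval I"
    and cont: "continuous_map (top_of_set I) (top_of_set I) f"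
    and opn: "open_map (top_of_set I) (top_of_set I) f"
  shows "finite {z \<in> I. f z = x}"
proof (cases "finite I \<or> x \<notin> f ` I")
  case True
  then have "finite I \<or> {z \<in> I. f z = x} = {}" by blast
  then show ?thesis by (metis (no_types, lifting) finite.emptyI finite_subset mem_Collect_eq subsetI)
next
  case False
  have contI: "continuous_on I f" and fI: "f ` I \<subseteq> I"
    using cont by auto
  have inf: "infinite I" and xI: "x \<in> I" using False fI by auto
  obtain a b where ab: "a < b" "b \<le> a + 2 * pi" "I = cis ` {a..b}"
    using arc_or_circle_parametrization[OF I inf] .
  have sub: "I \<subseteq> circle" using ab by auto
  define h where "h = f \<circ> cis"
  have conth: "continuous_on {a..b} h"
    unfolding h_def using contI ab(3) by (intro continuous_on_compose continuous_intros) auto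
  obtain C D where CD: "connected C" "connected D" "I - {x} = C \<union> D"
    using arc_or_circle_minus_point[OF I xI] .
  \<comment> \<open>One test point in each piece. For an empty piece \<open>SOME\<close> gives an arbitrary point, which may
    be \<open>x\<close>; it is removed because the test points have to stay away from \<open>x\<close>.\<close>
  define Y where "Y = {SOME y. y \<in> C, SOME y. y \<in> D} - {x}"
  have "finite Y" unfolding Y_def by simp
  have hits: "h ` {s..t} \<inter> Y \<noteq> {}"
    if st: "a \<le> s" "s < t" "t \<le> b" "h s = x" "h t = x" for s t
  proof -
    have "openin (top_of_set circle) (cis ` {s<..<t})"
      using st ab by (intro openin_arc) auto
    then have "openin (top_of_set I) (cis ` {s<..<t})"
      using sub st ab(3) by (intro openin_subset_trans[OF _ _ sub]) auto
    then have "openin (top_of_set I) (f ` cis ` {s<..<t})"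
      using opn unfolding open_map_def by blast
    then have o: "openin (top_of_set I) (h ` {s<..<t})"
      by (simp add: h_def image_comp)
    obtain r where "s < r" "r < t" using dense[OF st(2)] by blast
    then have "h r \<in> h ` {s<..<t}" by auto
    \<comment> \<open>A nonempty open subset of \<open>I\<close> is infinite, so the path cannot rest at \<open>x\<close>.\<close>
    then have "infinite (h ` {s<..<t})"
      using infinite_openin[OF o] islimpt_arc_or_circle[OF I inf] openin_imp_subset[OF o] by blast
    then have ne: "h ` {s<..<t} - {x} \<noteq> {}"
      using finite_subset[of _ "{x}"] by (auto simp only: Diff_eq_empty_iff)
    have "{s..t} = {s<..<t} \<union> {s, t}" using st by auto
    then have eq: "h ` {s..t} - {x} = h ` {s<..<t} - {x}" using st by auto
    have "compact (h ` {s..t})"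
      using st by (intro compact_continuous_image continuous_on_subset[OF conth]) auto
    then have "closedin (top_of_set (I - {x})) ((I - {x}) \<inter> h ` {s..t})"
      by (intro closedin_closed_Int compact_imp_closed)
    moreover have "(I - {x}) \<inter> h ` {s..t} = h ` {s<..<t} - {x}"
      using eq openin_imp_subset[OF o] by auto
    moreover have "openin (top_of_set (I - {x})) (h ` {s<..<t} - {x})"
    proof -
      obtain V where "open V" "h ` {s<..<t} = I \<inter> V" using o unfolding openin_open by metis
      then show ?thesis unfolding openin_open by blast
    qed
    ultimately have "C \<noteq> {} \<and> C \<subseteq> h ` {s<..<t} - {x} \<or> D \<noteq> {} \<and> D \<subseteq> h ` {s<..<t} - {x}"
      using nonempty_clopen_contains_connected_piece[OF CD ne] by metis
    then have "(h ` {s<..<t} - {x}) \<inter> Y \<noteq> {}"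
      unfolding Y_def using some_in_eq[of C] some_in_eq[of D] by blast
    then show ?thesis using eq by blast
  qed
  define F where "F = {t \<in> {a..b}. h t = x}"
  have "finite F"
  proof (rule ccontr)
    assume "infinite F"
    moreover have "F \<subseteq> {a..b}" unfolding F_def by auto
    ultimately obtain p where p: "p \<in> {a..b}" "p islimpt F"
      using Heine_Borel_imp_Bolzano_Weierstrass[of "{a..b}" F] by auto
    have "closed F"
      unfolding F_def using continuous_closed_preimage_constant[OF conth] by simp
    then have "h p = x" using p(2) closed_limpt F_def by blast
    then have "h p \<in> - Y" unfolding Y_def by simp
    moreover have "open (- Y)" using \<open>finite Y\<close> by (simp add: finite_imp_closed open_Compl)
    ultimately obtain V where V: "open V" "p \<in> V" "\<And>t. t \<in> {a..b} \<Longrightarrow> t \<in> V \<Longrightarrow> h t \<in> - Y"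
      using conth p(1) unfolding continuous_on_topological by metis
    then obtain d where d: "d > 0" "\<And>t. t \<in> {a..b} \<Longrightarrow> dist t p < d \<Longrightarrow> h t \<in> - Y"
      unfolding open_dist by blast
    obtain q where "q \<in> F" "q \<noteq> p" "dist q p < d"
      using p(2) d(1) unfolding islimpt_approachable by blast
    moreover have "p \<in> F" using p(1) \<open>h p = x\<close> unfolding F_def by simp
    ultimately obtain s t where st: "s \<in> F \<inter> ball p d" "t \<in> F \<inter> ball p d" "s < t"
      using d(1) by (cases "q < p") (force simp: dist_commute)+
    then have "h ` {s..t} \<inter> Y \<noteq> {}" using hits[of s t] unfolding F_def by auto
    then obtain r where "r \<in> {s..t}" "h r \<in> Y" by blast
    moreover have "r \<in> {a..b}" "dist r p < d"
      using \<open>r \<in> {s..t}\<close> st unfolding F_def by (auto simp: dist_real_def)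
    ultimately show False using d(2) by blast
  qed
  moreover have "{z \<in> I. f z = x} \<subseteq> cis ` F"
    unfolding F_def h_def ab(3) by auto
  ultimately show ?thesis using finite_surj by blast
qed

section \<open>Minimal sets of systems with finite fibres\<close>

lemma IFS_induct [consumes 1, case_names id comp]:
  assumes "\<phi> \<in> IFS n f"
    and "P id"
    and "\<And>i \<phi>. i \<in> {1..n} \<Longrightarrow> P \<phi> \<Longrightarrow> P (f i \<circ> \<phi>)"
  shows "P \<phi>"
proof -
  obtain w where w: "\<phi> = foldr (\<circ>) (map f w) id" "w \<in> lists {1..n}"
    using assms(1) unfolding IFS_def by blast
  have "P (foldr (\<circ>) (map f w) id)"
    using w(2)
  proof (induction w)
    case Nil
    then show ?case using assms(2) by (simp add: id_def)
  next
    case (Cons i w)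
    then show ?case using assms(3) by (simp add: comp_def)
  qed
  then show ?thesis using w(1) by simp
qed

lemma IFS_continuous_finite_fibres:
  assumes "\<phi> \<in> IFS n f"
    and cont: "\<And>i. i \<in> {1..n} \<Longrightarrow> continuous_map (top_of_set I) (top_of_set I) (f i)"
    and fin: "\<And>i x. i \<in> {1..n} \<Longrightarrow> finite {z \<in> I. f i z = x}"
  shows "continuous_map (top_of_set I) (top_of_set I) \<phi> \<and> (\<forall>x. finite {z \<in> I. \<phi> z = x})"
  using assms(1)
proof (induction rule: IFS_induct)
  case id
  have "{z \<in> I. id z = x} \<subseteq> {x}" for x by auto
  then have "finite {z \<in> I. id z = x}" for x by (rule finite_subset) simp
  then show ?case by simp
next
  case (comp i \<phi>)
  have "{z \<in> I. (f i \<circ> \<phi>) z = x} \<subseteq> (\<Union>y\<in>{y \<in> I. f i y = x}. {z \<in> I. \<phi> z = y})" for x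
    using comp(2) by auto
  moreover have "finite (\<Union>y\<in>{y \<in> I. f i y = x}. {z \<in> I. \<phi> z = y})" for x
    using comp fin by auto
  ultimately have "finite {z \<in> I. (f i \<circ> \<phi>) z = x}" for x by (rule finite_subset)
  then show ?case using comp cont continuous_map_compose by blast
qed

lemma IFS_maps_into:
  assumes "\<phi> \<in> IFS n f" "invariant_IFS n f M"
  shows "\<phi> ` M \<subseteq> M"
  using assms(1)
proof (induction rule: IFS_induct)
  case (comp i \<phi>)
  then show ?case using assms(2) unfolding invariant_IFS_def image_comp[symmetric] by blast
qed simp

text \<open>Every orbit in \<open>M\<close> is dense in \<open>M\<close> and hence visits each isolated point. If \<open>M\<close> is infinite, it
  accumulates at some \<open>p\<close>; a word that takes \<open>p\<close> to an isolated point \<open>x\<close> takes, by continuity, all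
  points of \<open>M\<close> near \<open>p\<close> to \<open>x\<close>, which is too many for a finite fibre.\<close>

lemma minimal_IFS_finite_or_perfect:
  assumes min: "minimal_IFS n f M" and MI: "M \<subseteq> I"
    and cont: "\<And>i. i \<in> {1..n} \<Longrightarrow> continuous_map (top_of_set I) (top_of_set I) (f i)"
    and fin: "\<And>i x. i \<in> {1..n} \<Longrightarrow> finite {z \<in> I. f i z = x}"
  shows "finite M \<or> (\<forall>x\<in>M. x islimpt M)"
proof (rule ccontr)
  assume "\<not> ?thesis"
  then obtain x where inf: "infinite M" and x: "x \<in> M" "\<not> x islimpt M" by blast
  then obtain U where U: "open U" "x \<in> U" "M \<inter> U \<subseteq> {x}"
    unfolding islimpt_def by blast
  have clo: "closedin (top_of_set circle) M" and inv: "invariant_IFS n f M"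
    and dense: "\<And>y. y \<in> M \<Longrightarrow> top_of_set circle closure_of orbit_IFS n f y = M"
    using min unfolding minimal_IFS_def by auto
  have "closed M" using clo closedin_closed_trans[OF _ closed_sphere] by blast
  moreover have "M \<subseteq> circle" using clo closedin_imp_subset by blast
  ultimately have "compact M"
    by (metis bounded_sphere bounded_subset compact_eq_bounded_closed)
  then obtain p where p: "p \<in> M" "p islimpt M"
    using Heine_Borel_imp_Bolzano_Weierstrass[of M M] inf by auto
  have "x \<in> top_of_set circle closure_of orbit_IFS n f p" using dense p(1) x(1) by simp
  moreover have "openin (top_of_set circle) (circle \<inter> U)" "x \<in> circle \<inter> U"
    using U x(1) \<open>M \<subseteq> circle\<close> by auto
  ultimately obtain y where "y \<in> orbit_IFS n f p" "y \<in> circle \<inter> U"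
    unfolding in_closure_of by blast
  then obtain \<phi> where \<phi>: "\<phi> \<in> IFS n f" "\<phi> p \<in> U" unfolding orbit_IFS_def by auto
  have cont\<phi>: "continuous_on M \<phi>" and fib: "finite {z \<in> I. \<phi> z = x}"
    using IFS_continuous_finite_fibres[OF \<phi>(1) cont fin] continuous_on_subset[OF _ MI] by auto
  obtain V where V: "open V" "p \<in> V" "\<And>z. z \<in> M \<Longrightarrow> z \<in> V \<Longrightarrow> \<phi> z \<in> U"
    using cont\<phi> p(1) U(1) \<phi>(2) unfolding continuous_on_topological by metis
  have "M \<inter> V \<subseteq> {z \<in> I. \<phi> z = x}"
    using V(3) U(3) IFS_maps_into[OF \<phi>(1) inv] MI by blast
  then have "finite (M \<inter> V)" using fib finite_subset by blast
  then show False using p(2) V(1,2) unfolding islimpt_eq_acc_point by (metis Int_commute)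
qed

section \<open>The countable part of a perfect set\<close>

lemma cantor_set_subset_residual:
  assumes "closedin (top_of_set circle) M" "C \<subseteq> M - interior_part M"
    and "C \<noteq> {}" "compact C" "\<And>x. x \<in> C \<Longrightarrow> x islimpt C"
  shows "cantor_set C"
  unfolding cantor_set_def
  using assms connected_subset_residual[OF assms(1)] by (metis order_trans)

text \<open>If the boundary of the interior part misses the countable part, then interior and Cantor
  part together form a closed set, and a point of the countable part has a small closed
  neighbourhood disjoint from it. In a perfect set that neighbourhood contains a Cantor set, which
  maximality would have placed in the Cantor part.\<close>

lemma frontier_meets_countable_part:
  assumes clo: "closedin (top_of_set circle) M"
    and perf: "\<And>x. x \<in> M \<Longrightarrow> x islimpt M"
    and N: "countable_part M \<noteq> {}"
  shows "(top_of_set circle frontier_of interior_part M) \<inter> countable_part M \<noteq> {}"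
proof
  assume dis: "(top_of_set circle frontier_of interior_part M) \<inter> countable_part M = {}"
  note dec = canonical_decomposition[OF clo]
  define G where "G = interior_part M \<union> cantor_part M"
  have "M \<subseteq> circle" using clo closedin_imp_subset by blast
  have "closed M" using clo closedin_closed_trans[OF _ closed_sphere] by blast
  have IM: "interior_part M \<subseteq> M" unfolding interior_part_def by (rule interior_of_subset)
  have cantor_max: "C \<subseteq> cantor_part M" if "cantor_set C" "C \<subseteq> M - interior_part M" for C
    using dec(5) that by (metis (no_types, lifting))
  have "cantor_part M = {} \<or> cantor_set (cantor_part M)"
    using dec(5) unfolding maximal_cantor_subset_def by metis
  then have "closed (cantor_part M)"
  proof
    assume "cantor_set (cantor_part M)"
    then show ?thesis unfolding cantor_set_def by (blast intro: compact_imp_closed)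
  qed simp
  moreover have "closure (interior_part M) \<subseteq> G"
  proof
    fix z assume z: "z \<in> closure (interior_part M)"
    then have "z \<in> M" using IM \<open>closed M\<close> closure_minimal by blast
    moreover have "z \<in> top_of_set circle closure_of interior_part M"
    proof -
      have "circle \<inter> interior_part M = interior_part M" using IM \<open>M \<subseteq> circle\<close> by blast
      then show ?thesis
        using z \<open>z \<in> M\<close> \<open>M \<subseteq> circle\<close> by (auto simp only: closure_of_subtopology euclidean_closure_of)
    qed
    ultimately show "z \<in> G"
      using dis dec(1) closure_of_subset unfolding G_def frontier_of_def interior_part_def
      by (auto simp: interior_of_interior_of)
  qed
  ultimately have "closed G"
  proof -
    have "G = closure (interior_part M) \<union> cantor_part M"
      using \<open>closure (interior_part M) \<subseteq> G\<close> closure_subset[of "interior_part M"]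
      unfolding G_def by blast
    then show ?thesis using \<open>closed (cantor_part M)\<close> by (metis closed_Un closed_closure)
  qed
  obtain y where y: "y \<in> countable_part M" using N by blast
  then have "y \<in> - G" using dec(3) G_def by blast
  then obtain e where e: "e > 0" "cball y e \<subseteq> - G"
    using \<open>closed G\<close> open_contains_cball by (metis open_Compl)
  define A where "A = M \<inter> ball y e"
  define C where "C = closure A"
  have "C \<subseteq> M \<inter> cball y e"
    unfolding C_def A_def using \<open>closed M\<close> ball_subset_cball by (intro closure_minimal) auto
  then have CG: "C \<subseteq> M - G" using e(2) by blast
  have "bounded C" using \<open>C \<subseteq> M \<inter> cball y e\<close> bounded_cball bounded_subset by blast
  have "y \<in> C"
    using y e(1) closure_subset[of A] unfolding C_def A_def countable_part_def by auto
  moreover have "compact C"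
    using \<open>bounded C\<close> unfolding C_def by (simp add: compact_eq_bounded_closed)
  moreover have "x islimpt C" if "x \<in> C" for x
  proof -
    have "z islimpt A" if "z \<in> A" for z
      unfolding A_def
    proof (rule islimpt_Int_eventually)
      show "z islimpt M" using that perf A_def by simp
      show "\<forall>\<^sub>F w in at z. w \<in> ball y e" using that A_def by (intro eventually_at_in_open') auto
    qed
    then have "x islimpt A" using \<open>x \<in> C\<close> unfolding C_def closure_def by auto
    then show ?thesis unfolding C_def using closure_subset by (rule islimpt_subset)
  qed
  ultimately have "cantor_set C"
    using CG by (intro cantor_set_subset_residual[OF clo]) (auto simp: G_def)
  then have "C \<subseteq> G" using cantor_max CG unfolding G_def by blast
  then show False using CG \<open>y \<in> C\<close> by blast
qed

section \<open>Minimal sets with empty and with nonempty interior\<close>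

theorem theorem1p1:
  fixes I M :: "complex set" and n :: nat and f :: "nat \<Rightarrow> complex \<Rightarrow> complex"
  assumes "I = circle \<or> circle_closed_interval I"
    and "1 \<le> n"
    and "\<And>i. i \<in> {1..n} \<Longrightarrow> continuous_map (top_of_set I) (top_of_set I) (f i)"
    and "\<And>i. i \<in> {1..n} \<Longrightarrow> open_map (top_of_set I) (top_of_set I) (f i)"
    and "M \<subseteq> I"
    and "minimal_IFS n f M"
  shows "(top_of_set circle interior_of M = {} \<longrightarrow> finite M \<or> cantor_set M) \<and>
    (top_of_set circle interior_of M \<noteq> {} \<longrightarrow>
      M = circle \<or>
      (M = interior_part M \<union> cantor_part M \<union> countable_part M \<and>
        (top_of_set circle frontier_of interior_part M) \<inter> countable_part M \<noteq> {}) \<or>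
      (M = interior_part M \<union> countable_part M \<and> cantor_part M = {}) \<or>
      (M = interior_part M \<union> cantor_part M \<and> countable_part M = {}))"
proof -
  have clo: "closedin (top_of_set circle) M" and "M \<noteq> {}"
    using assms(6) unfolding minimal_IFS_def by auto
  have "finite {z \<in> I. f i z = x}" if "i \<in> {1..n}" for i x
    using finite_fibre_open_map[OF assms(1)] assms(3,4) that by blast
  then have fp: "finite M \<or> (\<forall>x\<in>M. x islimpt M)"
    using minimal_IFS_finite_or_perfect[OF assms(6,5,3)] by blast
  show ?thesis
  proof (intro conjI impI)
    assume "top_of_set circle interior_of M = {}"
    moreover have "compact M"
      using closedin_compact[OF _ clo] by simp
    ultimately show "finite M \<or> cantor_set M"
      using fp cantor_set_subset_residual[OF clo, of M] \<open>M \<noteq> {}\<close>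
      unfolding interior_part_def by auto
  next
    assume "top_of_set circle interior_of M \<noteq> {}"
    then obtain x where x: "x \<in> top_of_set circle interior_of M" by blast
    have "x \<in> circle" using x interior_of_subset_topspace by fastforce
    then have "x islimpt circle" by (intro islimpt_arc_or_circle infinite_circle) auto
    then have "infinite (top_of_set circle interior_of M)"
      using infinite_openin[OF openin_interior_of x] by blast
    then have "infinite M" using finite_subset[OF interior_of_subset] by blast
    then have "\<forall>x\<in>M. x islimpt M" using fp by blast
    then show "M = circle \<or>
      (M = interior_part M \<union> cantor_part M \<union> countable_part M \<and>
        (top_of_set circle frontier_of interior_part M) \<inter> countable_part M \<noteq> {}) \<or>
      (M = interior_part M \<union> countable_part M \<and> cantor_part M = {}) \<or>
      (M = interior_part M \<union> cantor_part M \<and> countable_part M = {})"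
      using frontier_meets_countable_part[OF clo] canonical_decomposition(1)[OF clo] by blast
  qed
qed

end
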